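(* Let $k$ be a field, $\alpha$ a $k$-algebra automorphism of $k[[X]]$, and $\widehat{S}=k[[X]][\theta;\alpha]$. Let $1\le n<m$ and let $$z=\sum_{i=0}^n f_i\theta^i+\sum_{i=n+1}^m g_i\theta^i\in\widehat{S},$$ where $f_i,g_i\in k[[X]]$ and $g_m\ne 0$. Suppose that $f_n$ is invertible in $k[[X]]$ (that is, $X\nmid f_n$), and that $g_i$ is not invertible (that is, $g_i\in Xk[[X]]$) for all $i=n+1,\dots,m$. Then $z$ is divisible on the right by a monic polynomial in $\theta$ of degree $n$, i.e. $z\in\widehat{S}p$ for some $p\in\widehat{S}$ which is monic of degree $n$ in $\theta$. In particular, $z$ is reducible in $\widehat{S}$.
   Context: $k[[X]][\theta;\alpha]$ is the skew polynomial ring with $\theta r=\alpha(r)\theta$ for $r\in k[[X]]$. Reducible means: a product of two non-units of $\widehat{S}$. *)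

theory Defs
  imports
    "HOL-Algebra.Ring"
    "HOL-Computational_Algebra.Polynomial"
    "HOL-Computational_Algebra.Formal_Power_Series"
begin

definition fps_algebra_automorphism :: "('k::field fps \<Rightarrow> 'k fps) \<Rightarrow> bool" where
  "fps_algebra_automorphism \<alpha> \<longleftrightarrow>
     bij \<alpha> \<and> \<alpha> 1 = 1 \<and>
     (\<forall>a b. \<alpha> (a + b) = \<alpha> a + \<alpha> b) \<and>
     (\<forall>a b. \<alpha> (a * b) = \<alpha> a * \<alpha> b) \<and>
     (\<forall>c a. \<alpha> (fps_const c * a) = fps_const c * \<alpha> a)"

text \<open>
  The skew polynomial ring over \<open>R\<close> with \<open>\<theta> r = \<alpha>(r) \<theta>\<close>. A skew polynomial is written
  with its coefficients on the left, and \<open>\<Sum>i. a\<^sub>i \<theta>\<^sup>i\<close> is represented by the element of the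
  type \<open>R poly\<close> with coefficients \<open>a\<^sub>i\<close>; in particular \<open>monom a i\<close> stands for \<open>a \<theta>\<^sup>i\<close>. Only the
  additive structure, \<open>coeff\<close> and \<open>degree\<close> of that type are used: its own (commutative)
  multiplication is replaced by the one determined by
  \<open>(a \<theta>\<^sup>i) (b \<theta>\<^sup>j) = a \<alpha>\<^sup>i(b) \<theta>\<^sup>i\<^sup>+\<^sup>j\<close>.
\<close>

definition skew_mult :: "('r::comm_ring_1 \<Rightarrow> 'r) \<Rightarrow> 'r poly \<Rightarrow> 'r poly \<Rightarrow> 'r poly" where
  "skew_mult \<alpha> p q =
     (\<Sum>i\<le>degree p. \<Sum>j\<le>degree q. monom (coeff p i * (\<alpha> ^^ i) (coeff q j)) (i + j))"

definition skew_poly_ring :: "('r::comm_ring_1 \<Rightarrow> 'r) \<Rightarrow> 'r poly ring" where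
  "skew_poly_ring \<alpha> =
     \<lparr>carrier = UNIV, monoid.mult = skew_mult \<alpha>, one = 1, zero = 0, add = (+)\<rparr>"

definition reducible :: "('a, 'b) monoid_scheme \<Rightarrow> 'a \<Rightarrow> bool" where
  "reducible S z \<longleftrightarrow>
     (\<exists>a \<in> carrier S - Units S. \<exists>b \<in> carrier S - Units S. z = a \<otimes>\<^bsub>S\<^esub> b)"

context
  fixes \<alpha> :: "'r::comm_ring_1 \<Rightarrow> 'r"
  assumes one: "\<alpha> 1 = 1"
    and add: "\<And>a b. \<alpha> (a + b) = \<alpha> a + \<alpha> b"
    and mult: "\<And>a b. \<alpha> (a * b) = \<alpha> a * \<alpha> b"
begin

lemma pow_one: "(\<alpha> ^^ i) 1 = 1"
  by (induction i) (auto simp: one)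

lemma pow_add: "(\<alpha> ^^ i) (a + b) = (\<alpha> ^^ i) a + (\<alpha> ^^ i) b"
  by (induction i) (auto simp: add)

lemma pow_mult: "(\<alpha> ^^ i) (a * b) = (\<alpha> ^^ i) a * (\<alpha> ^^ i) b"
  by (induction i) (auto simp: mult)

lemma pow_zero: "(\<alpha> ^^ i) 0 = 0"
  using pow_add[of i 0 0] by simp

lemma skew_mult_bound:
  assumes "degree p \<le> N" "degree q \<le> M"
  shows "skew_mult \<alpha> p q = (\<Sum>i\<le>N. \<Sum>j\<le>M. monom (coeff p i * (\<alpha> ^^ i) (coeff q j)) (i + j))"
proof -
  have "(\<Sum>j\<le>M. monom (coeff p i * (\<alpha> ^^ i) (coeff q j)) (i + j)) =
        (\<Sum>j\<le>degree q. monom (coeff p i * (\<alpha> ^^ i) (coeff q j)) (i + j))" for i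
    using assms by (intro sum.mono_neutral_right) (auto simp: coeff_eq_0 pow_zero)
  moreover have "(\<Sum>i\<le>N. \<Sum>j\<le>degree q. monom (coeff p i * (\<alpha> ^^ i) (coeff q j)) (i + j)) =
        skew_mult \<alpha> p q"
    unfolding skew_mult_def
    using assms by (intro sum.mono_neutral_right) (auto simp: coeff_eq_0)
  ultimately show ?thesis by simp
qed

lemma skew_mult_add_left: "skew_mult \<alpha> (p + q) r = skew_mult \<alpha> p r + skew_mult \<alpha> q r"
proof -
  let ?N = "max (degree p) (degree q)"
  have "degree (p + q) \<le> ?N" by (rule degree_add_le_max)
  then show ?thesis
    by (simp add: skew_mult_bound[of _ ?N _ "degree r"] sum.distrib[symmetric]
        distrib_right add_monom)
qed

lemma skew_mult_add_right: "skew_mult \<alpha> r (p + q) = skew_mult \<alpha> r p + skew_mult \<alpha> r q"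
proof -
  let ?N = "max (degree p) (degree q)"
  have "degree (p + q) \<le> ?N" by (rule degree_add_le_max)
  then show ?thesis
    by (simp add: skew_mult_bound[of _ "degree r" _ ?N] sum.distrib[symmetric]
        distrib_left pow_add add_monom)
qed

lemma skew_mult_monom: "skew_mult \<alpha> (monom a i) (monom b j) = monom (a * (\<alpha> ^^ i) b) (i + j)"
proof -
  have "skew_mult \<alpha> (monom a i) (monom b j) = 
    (\<Sum>i'\<le>i. \<Sum>j'\<le>j. if j' = j then (if i' = i then monom (a * (\<alpha> ^^ i) b) (i + j) else 0) else 0)"
    unfolding skew_mult_bound[OF degree_monom_le degree_monom_le]
    by (intro sum.cong refl) (auto simp: pow_zero)
  then show ?thesis by simp
qed

lemma poly_monom_induct:
  fixes p :: "'r poly"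
  assumes "\<And>a i. P (monom a i)" "\<And>p q. P p \<Longrightarrow> P q \<Longrightarrow> P (p + q)"
  shows "P p"
proof -
  have "P (\<Sum>i\<le>n. monom (coeff p i) i)" for n
    by (induction n) (auto intro: assms)
  then show ?thesis by (metis poly_as_sum_of_monoms)
qed

lemma skew_mult_assoc: "skew_mult \<alpha> (skew_mult \<alpha> p q) r = skew_mult \<alpha> p (skew_mult \<alpha> q r)"
proof (induction p rule: poly_monom_induct)
  case (1 a i)
  show ?case
  proof (induction q rule: poly_monom_induct)
    case (1 b j)
    show ?case
    proof (induction r rule: poly_monom_induct)
      case (1 c l)
      show ?case by (simp add: skew_mult_monom pow_mult funpow_add mult.assoc add.assoc)
    qed (simp add: skew_mult_add_right)
  qed (simp add: skew_mult_add_right skew_mult_add_left)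
qed (simp add: skew_mult_add_left)

lemma skew_mult_one_left: "skew_mult \<alpha> 1 p = p"
proof (induction p rule: poly_monom_induct)
  case (1 a i)
  show ?case using skew_mult_monom[of 1 0 a i] by (simp add: monom_0 one_pCons)
qed (simp add: skew_mult_add_right)

lemma skew_mult_one_right: "skew_mult \<alpha> p 1 = p"
proof (induction p rule: poly_monom_induct)
  case (1 a i)
  show ?case using skew_mult_monom[of a i 1 0] by (simp add: monom_0 pow_one one_pCons)
qed (simp add: skew_mult_add_left)

lemma ring_skew_poly_ring: "ring (skew_poly_ring \<alpha>)"
proof (rule ringI)
  show "abelian_group (skew_poly_ring \<alpha>)"
  proof (rule abelian_groupI)
    fix x assume "x \<in> carrier (skew_poly_ring \<alpha>)"
    show "\<exists>y\<in>carrier (skew_poly_ring \<alpha>). y \<oplus>\<^bsub>skew_poly_ring \<alpha>\<^esub> x = \<zero>\<^bsub>skew_poly_ring \<alpha>\<^esub>"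
      by (rule bexI[of _ "- x"]) (auto simp: skew_poly_ring_def)
  qed (auto simp: skew_poly_ring_def algebra_simps)
  show "Group.monoid (skew_poly_ring \<alpha>)"
    by (rule monoidI)
      (auto simp: skew_poly_ring_def skew_mult_assoc skew_mult_one_left skew_mult_one_right)
qed (auto simp: skew_poly_ring_def skew_mult_add_left skew_mult_add_right)

lemma skew_commutation:
  "monom 1 1 \<otimes>\<^bsub>skew_poly_ring \<alpha>\<^esub> [:r:] = [:\<alpha> r:] \<otimes>\<^bsub>skew_poly_ring \<alpha>\<^esub> monom 1 1"
  using skew_mult_monom[of 1 1 r 0] skew_mult_monom[of "\<alpha> r" 0 1 1]
  by (simp add: skew_poly_ring_def monom_0)

lemma monom_eq_const_mult_power:
  "monom a i = [:a:] \<otimes>\<^bsub>skew_poly_ring \<alpha>\<^esub> (monom 1 1 [^]\<^bsub>skew_poly_ring \<alpha>\<^esub> i)"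
proof -
  interpret ring "skew_poly_ring \<alpha>" by (rule ring_skew_poly_ring)
  have "monom 1 1 [^]\<^bsub>skew_poly_ring \<alpha>\<^esub> i = monom 1 i"
  proof (induction i)
    case 0
    show ?case by (simp add: skew_poly_ring_def monom_0 one_pCons)
  next
    case (Suc i)
    then show ?case
      using skew_mult_monom[of 1 i 1 1] by (simp add: pow_one skew_poly_ring_def)
  qed
  then show ?thesis
    using skew_mult_monom[of a 0 1 i] by (simp add: skew_poly_ring_def monom_0)
qed

end

end

theory Submission
  imports Defs
begin

text \<open>
  The factorization is obtained by Hensel lifting along the powers of \<open>X\<close>. Modulo \<open>X\<close> the
  polynomial \<open>z\<close> has degree \<open>n\<close> with unit leading coefficient \<open>c = f\<^sub>n\<close>, so \<open>z \<equiv> c p\<^sub>0\<close> with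
  \<open>p\<^sub>0\<close> monic of degree \<open>n\<close>. Given an approximation \<open>z \<equiv> q p (mod X\<^sup>k)\<close> with \<open>q \<equiv> c (mod X)\<close>
  and \<open>p\<close> monic of degree \<open>n\<close>, right division of the error by \<open>p\<close> gives \<open>z - q p = s p + r\<close>
  with \<open>deg r < n\<close>, and both \<open>s\<close> and \<open>r\<close> inherit divisibility by \<open>X\<^sup>k\<close> because \<open>p\<close> is monic.
  Replacing \<open>q\<close> by \<open>q + s\<close> and \<open>p\<close> by \<open>p + c\<^sup>-\<^sup>1 r\<close> leaves the error
  \<open>- (q - c) c\<^sup>-\<^sup>1 r - s c\<^sup>-\<^sup>1 r\<close>, which vanishes modulo \<open>X\<^sup>k\<^sup>+\<^sup>1\<close>
  (\<open>approx_factorization_lift\<close>). The degrees of the factors stay bounded, so the approximations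
  converge coefficientwise (\<open>poly_fps_limit\<close>) to factors whose product is \<open>z\<close>
  (\<open>skew_preparation\<close>).

  In the lifting, the twist by \<open>\<alpha>\<close> is harmless: \<open>\<alpha>\<close> fixes \<open>1\<close>, which allows right division by
  monic polynomials, and it respects divisibility by \<open>X\<close>, by the fact that \<open>\<alpha>\<close> maps \<open>X\<close> to a multiple of \<open>X\<close>
  (\<open>fps_X_dvd_image\<close>): a power of \<open>X\<close> dividing all coefficients of one factor of a skew
  product then divides all coefficients of the product.

  Reducibility follows by counting degrees. As \<open>\<alpha>\<close> is injective, degrees add in skew products, so
  units have degree \<open>0\<close>, whereas the two factors have degrees \<open>n > 0\<close> and \<open>m - n > 0\<close>.

  Throughout, \<open>[:d:] dvd p\<close> in the commutative polynomial ring expresses that \<open>d\<close> divides every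
  coefficient of \<open>p\<close>.
\<close>

section \<open>Skew multiplication over an integral domain\<close>

text \<open>
  The facts about skew products are instantiated once with the fixed \<open>\<alpha>\<close>, as unifying their
  homomorphism premises with a schematic \<open>\<alpha>\<close> is a costly higher-order problem.
\<close>

locale ring_endomorphism =
  fixes \<alpha> :: "'r::idom \<Rightarrow> 'r"
  assumes hom: "\<alpha> 1 = 1" "\<And>a b. \<alpha> (a + b) = \<alpha> a + \<alpha> b" "\<And>a b. \<alpha> (a * b) = \<alpha> a * \<alpha> b"
begin

lemmas skew_left_distrib = skew_mult_add_left[of \<alpha>, OF hom]
lemmas skew_right_distrib = skew_mult_add_right[of \<alpha>, OF hom]
lemmas skew_monom = skew_mult_monom[of \<alpha>, OF hom]
lemmas skew_expand = skew_mult_bound[of \<alpha>, OF hom]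
lemmas skew_one_right = skew_mult_one_right[of \<alpha>, OF hom]
lemmas funpow_one = pow_one[of \<alpha>, OF hom]
lemmas funpow_zero = pow_zero[of \<alpha>, OF hom]

lemma skew_mult_diff_left: "skew_mult \<alpha> (p - q) r = skew_mult \<alpha> p r - skew_mult \<alpha> q r"
  using skew_left_distrib[of "p - q" q r] by (simp add: algebra_simps)

lemma skew_mult_diff_right: "skew_mult \<alpha> r (p - q) = skew_mult \<alpha> r p - skew_mult \<alpha> r q"
  using skew_right_distrib[of r "p - q" q] by (simp add: algebra_simps)

lemma skew_mult_zero_left: "skew_mult \<alpha> 0 r = 0"
  using skew_mult_diff_left[of 0 0 r] by simp

lemma skew_mult_zero_right: "skew_mult \<alpha> r 0 = 0"
  using skew_mult_diff_right[of r 0 0] by simp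

lemma skew_mult_const_left: "skew_mult \<alpha> [:c:] p = smult c p"
proof (induction p rule: poly_monom_induct[of \<alpha>, OF hom])
  case (1 a i)
  show ?case using skew_monom[of c 0 a i] by (simp add: monom_0 smult_monom)
next
  case (2 p q)
  then show ?case by (simp add: skew_right_distrib smult_add_right)
qed

lemma degree_skew_mult_le: "degree (skew_mult \<alpha> p q) \<le> degree p + degree q"
  unfolding skew_mult_def
  by (intro degree_sum_le finite_atMost order.trans[OF degree_monom_le]) simp

lemma coeff_skew_mult_top:
  assumes "degree p \<le> N" "degree q \<le> M"
  shows "coeff (skew_mult \<alpha> p q) (N + M) = coeff p N * (\<alpha> ^^ N) (coeff q M)"
proof -
  have "coeff (skew_mult \<alpha> p q) (N + M) =
      (\<Sum>i\<le>N. \<Sum>j\<le>M. if j = M then if i = N then coeff p N * (\<alpha> ^^ N) (coeff q M) else 0 else 0)"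
    unfolding skew_expand[OF assms] coeff_sum by (intro sum.cong refl) auto
  then show ?thesis by simp
qed

lemma degree_skew_mult:
  assumes "inj \<alpha>" "p \<noteq> 0" "q \<noteq> 0"
  shows "degree (skew_mult \<alpha> p q) = degree p + degree q"
proof (rule antisym[OF degree_skew_mult_le])
  have "(\<alpha> ^^ i) a \<noteq> 0" if "a \<noteq> 0" for i a
    using inj_fn[OF assms(1), of i] that by (metis injD funpow_zero)
  then have "coeff (skew_mult \<alpha> p q) (degree p + degree q) \<noteq> 0"
    using assms by (simp add: coeff_skew_mult_top)
  then show "degree p + degree q \<le> degree (skew_mult \<alpha> p q)"
    by (rule le_degree)
qed

lemma dvd_funpow:
  assumes "d dvd \<alpha> d" "d dvd a" shows "d dvd (\<alpha> ^^ i) a"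
proof (induction i)
  case (Suc i)
  then obtain b where "(\<alpha> ^^ i) a = d * b" by auto
  then show ?case using assms by (simp add: hom)
qed (simp add: assms)

lemma dvd_power_image:
  assumes "d dvd \<alpha> d" shows "d ^ j dvd \<alpha> (d ^ j)"
proof (induction j)
  case (Suc j)
  then show ?case using assms by (simp add: hom mult_dvd_mono)
qed (simp add: hom)

text \<open>
  Moving \<open>e\<close> to the left past \<open>\<theta>\<^sup>i\<close> turns it into \<open>\<alpha>\<^sup>i(e)\<close>, which is still a multiple of \<open>e\<close>.
\<close>

lemma const_dvd_skew_mult:
  assumes "[:d:] dvd p" "[:e:] dvd q" "e dvd \<alpha> e"
  shows "[:d * e:] dvd skew_mult \<alpha> p q"
proof -
  have "d * e dvd coeff p i * (\<alpha> ^^ i) (coeff q j)" for i j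
    using assms unfolding const_poly_dvd_iff by (blast intro: mult_dvd_mono dvd_funpow)
  then have "[:d * e:] dvd monom (coeff p i * (\<alpha> ^^ i) (coeff q j)) (i + j)" for i j
    by (simp add: const_poly_dvd_iff)
  then show ?thesis unfolding skew_mult_def by (intro dvd_sum)
qed

text \<open>
  Right division cancels top coefficients as usual: \<open>(b \<theta>\<^sup>i) p\<close> has leading coefficient \<open>b\<close> since
  \<open>\<alpha>\<close> fixes the leading coefficient \<open>1\<close> of \<open>p\<close>. Each step subtracts a multiple of a coefficient of
  the current dividend, so a common divisor \<open>d\<close> of the coefficients survives in quotient and
  remainder. The remainder is bounded by vanishing coefficients instead of a degree so that \<open>n = 0\<close>
  is covered.
\<close>

lemma skew_division_by_monic:
  assumes "degree p = n" "coeff p n = 1" "d dvd \<alpha> d"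
  shows "[:d:] dvd e \<Longrightarrow> degree e \<le> N \<Longrightarrow>
    \<exists>s r. e = skew_mult \<alpha> s p + r \<and> [:d:] dvd s \<and> [:d:] dvd r \<and>
      degree s \<le> N - n \<and> (\<forall>i\<ge>n. coeff r i = 0)"
proof (induction N arbitrary: e)
  case base: 0
  show ?case
  proof (cases "n = 0")
    case True
    then have "p = 1" using assms base by (auto elim!: degree_eq_zeroE simp: one_pCons)
    then show ?thesis using base True
      by (intro exI[of _ e] exI[of _ 0]) (simp add: skew_one_right)
  next
    case False
    then show ?thesis using base
      by (intro exI[of _ 0] exI[of _ e]) (auto simp: skew_mult_zero_left coeff_eq_0)
  qed
next
  case (Suc N)
  show ?case
  proof (cases "n \<le> Suc N")
    case False
    then show ?thesis using Suc.prems
      by (intro exI[of _ 0] exI[of _ e]) (auto simp: skew_mult_zero_left coeff_eq_0)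
  next
    case True
    define t where "t = monom (coeff e (Suc N)) (Suc N - n)"
    have dt: "degree t \<le> Suc N - n" and dvd_t: "[:d:] dvd t"
      using Suc.prems by (auto simp: t_def degree_monom_le const_poly_dvd_iff)
    let ?e = "e - skew_mult \<alpha> t p"
    have "coeff (skew_mult \<alpha> t p) (Suc N) = coeff e (Suc N)"
      using coeff_skew_mult_top[OF dt, of p n] assms True by (simp add: funpow_one t_def)
    moreover have "degree (skew_mult \<alpha> t p) \<le> Suc N"
      using degree_skew_mult_le[of t p] dt assms True by linarith
    ultimately have "degree ?e \<le> N"
      using Suc.prems(2) by (intro degree_le)
        (metis Suc_lessI coeff_diff coeff_eq_0 diff_self order.strict_trans1)
    moreover have "[:d:] dvd ?e"
      using const_dvd_skew_mult[of d t 1 p] dvd_t Suc.prems by (simp add: hom const_poly_dvd_iff)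
    ultimately obtain s r where sr: "?e = skew_mult \<alpha> s p + r" "[:d:] dvd s" "[:d:] dvd r"
      "degree s \<le> N - n" "\<forall>i\<ge>n. coeff r i = 0"
      using Suc.IH by blast
    have "degree (s + t) \<le> Suc N - n"
      using sr dt by (intro degree_add_le) auto
    moreover have "e = skew_mult \<alpha> (s + t) p + r"
      using sr by (simp add: skew_left_distrib algebra_simps)
    ultimately show ?thesis using sr dvd_add[OF sr(2) dvd_t]
      by (intro exI[of _ "s + t"] exI[of _ r]) simp
  qed
qed

end

section \<open>Lifting a factorization from one power to the next\<close>

text \<open>
  The condition \<open>q \<equiv> c (mod x)\<close> is what makes the next correction solvable: modulo \<open>x\<close> the
  left factor acts as multiplication by the unit \<open>c\<close>. The degree bounds keep the coefficientwise
  limits polynomials of the right degree.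
\<close>

definition approx_factorization ::
  "('r::comm_ring_1 \<Rightarrow> 'r) \<Rightarrow> 'r \<Rightarrow> 'r \<Rightarrow> nat \<Rightarrow> nat \<Rightarrow> 'r poly \<Rightarrow> nat \<Rightarrow> 'r poly \<times> 'r poly \<Rightarrow> bool" where
  "approx_factorization \<alpha> x c n m z k = (\<lambda>(q, p).
     degree p = n \<and> coeff p n = 1 \<and> degree q \<le> m - n \<and>
     [:x:] dvd q - [:c:] \<and> [:x ^ k:] dvd z - skew_mult \<alpha> q p)"

text \<open>
  The remainder \<open>r\<close> is absorbed by changing \<open>p\<close> by \<open>c' r\<close>, the quotient \<open>s\<close> by changing \<open>q\<close>. What is
  left over are the products \<open>(q - c) (c' r)\<close> and \<open>s (c' r)\<close>; the first gains a factor \<open>x\<close> from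
  \<open>q \<equiv> c\<close>, the second a factor \<open>x\<^sup>k\<close> from \<open>s\<close>. Since \<open>1 \<le> k\<close>, the latter is enough, and
  \<open>q + s \<equiv> c (mod x)\<close> persists.
\<close>

lemma (in ring_endomorphism) approx_factorization_lift:
  assumes "x dvd \<alpha> x" "c * c' = 1" "n \<le> m" "degree z \<le> m" "1 \<le> k"
    and "approx_factorization \<alpha> x c n m z k (q, p)"
  shows "\<exists>q' p'. approx_factorization \<alpha> x c n m z (Suc k) (q', p') \<and>
           [:x ^ k:] dvd q' - q \<and> [:x ^ k:] dvd p' - p"
proof -
  have p: "degree p = n" "coeff p n = 1" and q: "degree q \<le> m - n" "[:x:] dvd q - [:c:]"
    and e: "[:x ^ k:] dvd z - skew_mult \<alpha> q p"
    using assms by (auto simp: approx_factorization_def)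
  have xk: "x ^ k dvd \<alpha> (x ^ k)" by (rule dvd_power_image) fact
  have "degree (skew_mult \<alpha> q p) \<le> m"
    using degree_skew_mult_le[of q p] p q assms by linarith
  then have "degree (z - skew_mult \<alpha> q p) \<le> m" using assms by (intro degree_diff_le) auto
  then obtain s r where sr: "z - skew_mult \<alpha> q p = skew_mult \<alpha> s p + r" "[:x ^ k:] dvd s"
      "[:x ^ k:] dvd r" "degree s \<le> m - n" "\<forall>i\<ge>n. coeff r i = 0"
    using skew_division_by_monic[OF p xk e] by metis
  have xs: "[:x:] dvd s" using sr(2) \<open>1 \<le> k\<close>
    by (auto simp: const_poly_dvd_iff intro: dvd_trans[OF dvd_power[of k x]])
  define r' where "r' = smult c' r"
  have r': "[:x ^ k:] dvd r'" using sr by (auto simp: r'_def intro: dvd_smult)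
  have "r = skew_mult \<alpha> [:c:] r'" using assms by (simp add: r'_def skew_mult_const_left)
  then have err: "z - skew_mult \<alpha> (q + s) (p + r') =
      - (skew_mult \<alpha> (q - [:c:]) r' + skew_mult \<alpha> s r')"
    using sr(1) by (simp add: skew_left_distrib skew_right_distrib
        skew_mult_diff_left algebra_simps)
  have "[:x * x ^ k:] dvd skew_mult \<alpha> (q - [:c:]) r'"
    by (intro const_dvd_skew_mult q r' xk)
  moreover have "[:x * x ^ k:] dvd skew_mult \<alpha> s r'"
    by (intro const_dvd_skew_mult xs r' xk)
  ultimately have "[:x ^ Suc k:] dvd z - skew_mult \<alpha> (q + s) (p + r')"
    unfolding err by simp
  moreover have c: "coeff (p + r') i = coeff p i" if "i \<ge> n" for i
    using sr that by (simp add: r'_def)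
  have "degree (p + r') = n"
  proof (rule antisym)
    show "degree (p + r') \<le> n" using c p by (intro degree_le) (auto simp: coeff_eq_0)
    show "n \<le> degree (p + r')" using c[of n] p by (intro le_degree) auto
  qed
  moreover have "degree (q + s) \<le> m - n" using q sr by (intro degree_add_le)
  moreover have "[:x:] dvd q + s - [:c:]"
    using dvd_add[OF q(2) xs] by (simp add: algebra_simps)
  ultimately have "approx_factorization \<alpha> x c n m z (Suc k) (q + s, p + r')"
    using c[of n] p by (simp add: approx_factorization_def)
  then show ?thesis using sr r' by (intro exI[of _ "q + s"] exI[of _ "p + r'"]) simp
qed

section \<open>Divisibility by powers of X and X-adic limits\<close>

unbundle fps_syntax

lemma fps_X_power_dvd_iff: "fps_X ^ k dvd (a :: 'k::field fps) \<longleftrightarrow> (\<forall>i<k. a $ i = 0)"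
proof (cases "a = 0")
  case False
  then have "fps_X ^ k dvd a \<longleftrightarrow> k \<le> subdegree a" by (simp add: fps_dvd_iff)
  also have "\<dots> \<longleftrightarrow> (\<forall>i<k. a $ i = 0)"
    using False by (metis nth_less_subdegree_zero order.strict_trans2 subdegree_geI)
  finally show ?thesis .
qed simp

text \<open>
  Units are the power series not divisible by \<open>X\<close>; if \<open>\<alpha>(X)\<close> were a unit, applying the inverse
  automorphism would make \<open>X\<close> a unit.
\<close>

lemma fps_X_dvd_image:
  fixes \<alpha> :: "'k::field fps \<Rightarrow> 'k fps"
  assumes "bij \<alpha>" "\<alpha> 1 = 1" "\<And>a b. \<alpha> (a * b) = \<alpha> a * \<alpha> b"
  shows "fps_X dvd \<alpha> fps_X"
proof (rule ccontr)
  assume "\<not> fps_X dvd \<alpha> fps_X"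
  then have "is_unit (\<alpha> fps_X)" using fps_X_power_dvd_iff[of 1 "\<alpha> fps_X"] by simp
  then obtain v where v: "\<alpha> fps_X * v = 1" by (metis dvd_def)
  obtain w where "v = \<alpha> w" using assms(1) by (metis bij_pointE)
  then have "\<alpha> (fps_X * w) = \<alpha> 1" using v assms by simp
  then have "fps_X * w = 1" using assms(1) by (metis bij_is_inj injD)
  then have "is_unit (fps_X :: 'k fps)" by (metis dvd_triv_left)
  then show False by simp
qed

text \<open>
  Consecutive members agree modulo ever higher powers of \<open>X\<close>, so the coefficient of \<open>X\<^sup>k\<close> in
  each coefficient is constant from the \<open>k\<close>-th member on; the limit reads it off there. The common
  degree bound makes the limit a polynomial in \<open>\<theta>\<close>.
\<close>

lemma poly_fps_limit:
  fixes P :: "nat \<Rightarrow> 'k::field fps poly"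
  assumes deg: "\<And>k. degree (P k) \<le> N"
    and step: "\<And>k. [:fps_X ^ Suc k:] dvd P (Suc k) - P k"
  obtains L where "degree L \<le> N" "\<And>k. [:fps_X ^ Suc k:] dvd L - P k"
proof -
  define L where "L = (\<Sum>i\<le>N. monom (Abs_fps (\<lambda>k. coeff (P k) i $ k)) i)"
  have stable: "coeff (P (j + l)) i $ j = coeff (P j) i $ j" for i j l
  proof (induction l)
    case (Suc l)
    have "(coeff (P (Suc (j + l))) i - coeff (P (j + l)) i) $ j = 0"
      using step[of "j + l"]
      unfolding const_poly_dvd_iff fps_X_power_dvd_iff coeff_diff by simp
    then show ?case using Suc by simp
  qed simp
  have coeff_L: "coeff L i = (if i \<le> N then Abs_fps (\<lambda>k. coeff (P k) i $ k) else 0)" for i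
    by (simp add: L_def coeff_sum)
  show ?thesis
  proof
    show "degree L \<le> N" by (intro degree_le) (simp add: coeff_L)
    fix k
    have "(coeff L i - coeff (P k) i) $ j = 0" if "j < Suc k" for i j
    proof (cases "i \<le> N")
      case True
      then show ?thesis using stable[of j "k - j" i] that by (simp add: coeff_L)
    next
      case False
      then show ?thesis using deg[of k] by (simp add: coeff_L coeff_eq_0)
    qed
    then show "[:fps_X ^ Suc k:] dvd L - P k"
      unfolding const_poly_dvd_iff fps_X_power_dvd_iff coeff_diff by blast
  qed
qed

text \<open>
  A skew analogue of Weierstrass preparation. The lifting starts from \<open>q = c\<close> and
  \<open>p = c\<^sup>-\<^sup>1 \<Sum>\<^sub>i\<^sub>\<le>\<^sub>n z\<^sub>i \<theta>\<^sup>i\<close> with \<open>c = z\<^sub>n\<close>, whose product differs from \<open>z\<close> by the coefficients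
  above \<open>n\<close>, all multiples of \<open>X\<close>. The limit of the factors is an exact factorization, because
  its error is divisible by every power of \<open>X\<close>.
\<close>

lemma skew_preparation:
  fixes \<alpha> :: "'k::field fps \<Rightarrow> 'k fps"
  assumes "ring_endomorphism \<alpha>" and X: "fps_X dvd \<alpha> fps_X"
    and z: "degree z \<le> m" "n \<le> m" "is_unit (coeff z n)"
    and high: "\<And>i. n < i \<Longrightarrow> fps_X dvd coeff z i"
  shows "\<exists>q p. degree p = n \<and> lead_coeff p = 1 \<and> z = skew_mult \<alpha> q p"
proof -
  interpret ring_endomorphism \<alpha> by fact
  let ?A = "approx_factorization \<alpha> fps_X (coeff z n) n m z"
  obtain c' where c': "coeff z n * c' = 1" using z by (metis dvd_def)
  define p0 where "p0 = smult c' (\<Sum>i\<le>n. monom (coeff z i) i)"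
  have coeff_p0: "coeff p0 i = (if i \<le> n then c' * coeff z i else 0)" for i
    by (simp add: p0_def coeff_sum)
  \<comment> \<open>The exponents start at \<open>1\<close>: the lifting step gains nothing from an approximation modulo \<open>X\<^sup>0\<close>.\<close>
  have "?A (Suc 0) ([:coeff z n:], p0)"
  proof -
    have "degree p0 \<le> n" by (intro degree_le) (simp add: coeff_p0)
    moreover have "coeff p0 n = 1" using c' by (simp add: coeff_p0 mult.commute)
    ultimately have "degree p0 = n" by (metis antisym le_degree one_neq_zero)
    moreover have "fps_X dvd coeff z i - coeff z n * coeff p0 i" for i
      using high[of i] c' by (simp add: coeff_p0 mult.assoc[symmetric])
    ultimately show ?thesis using \<open>coeff p0 n = 1\<close>
      by (simp add: approx_factorization_def skew_mult_const_left
          const_poly_dvd_iff)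
  qed
  moreover have "\<exists>y. ?A (Suc (Suc k)) y \<and>
      [:fps_X ^ Suc k:] dvd fst y - fst x \<and> [:fps_X ^ Suc k:] dvd snd y - snd x"
    if "?A (Suc k) x" for x k
    using approx_factorization_lift[OF X c' z(2,1), of "Suc k" "fst x" "snd x"] that
    by auto
  ultimately obtain h where h: "\<And>k. ?A (Suc k) (h k)"
    "\<And>k. [:fps_X ^ Suc k:] dvd fst (h (Suc k)) - fst (h k)"
    "\<And>k. [:fps_X ^ Suc k:] dvd snd (h (Suc k)) - snd (h k)"
    using dependent_nat_choice[of "\<lambda>k. ?A (Suc k)" "\<lambda>k x y.
        [:fps_X ^ Suc k:] dvd fst y - fst x \<and> [:fps_X ^ Suc k:] dvd snd y - snd x"]
    by blast
  have A: "degree (snd (h k)) = n" "coeff (snd (h k)) n = 1" "degree (fst (h k)) \<le> m - n"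
      "[:fps_X ^ Suc k:] dvd z - skew_mult \<alpha> (fst (h k)) (snd (h k))" for k
    using h(1)[of k] by (simp_all add: approx_factorization_def case_prod_beta)
  obtain q where q: "\<And>k. [:fps_X ^ Suc k:] dvd q - fst (h k)"
    using poly_fps_limit[of "\<lambda>k. fst (h k)"] A h by metis
  obtain p where p: "degree p \<le> n" "\<And>k. [:fps_X ^ Suc k:] dvd p - snd (h k)"
    using poly_fps_limit[of "\<lambda>k. snd (h k)" n] A h by (metis order.refl)
  \<comment> \<open>The \<open>X\<close>-adic topology is separated, so identities may be checked modulo all powers of \<open>X\<close>.\<close>
  have separated: "a = 0" if "\<And>k. fps_X ^ Suc k dvd a" for a :: "'k fps"
  proof (rule fps_ext)
    fix i
    show "a $ i = 0 $ i" using that[of i] unfolding fps_X_power_dvd_iff by simp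
  qed
  have "coeff p n - 1 = 0"
  proof (rule separated)
    fix k
    have "fps_X ^ Suc k dvd coeff (p - snd (h k)) n" using p(2) unfolding const_poly_dvd_iff by blast
    then show "fps_X ^ Suc k dvd coeff p n - 1" by (simp add: A)
  qed
  then have "coeff p n = 1" by simp
  moreover from this p have "degree p = n" by (metis antisym le_degree one_neq_zero)
  moreover have "z - skew_mult \<alpha> q p = 0"
  proof (rule poly_eqI)
    fix i
    have "coeff (z - skew_mult \<alpha> q p) i = 0"
    proof (rule separated)
      fix k
      let ?q = "fst (h k)" and ?p = "snd (h k)"
      have "z - skew_mult \<alpha> q p = (z - skew_mult \<alpha> ?q ?p) -
          (skew_mult \<alpha> (q - ?q) ?p + skew_mult \<alpha> q (p - ?p))"
        by (simp add: skew_mult_diff_left skew_mult_diff_right)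
      moreover have "[:fps_X ^ Suc k:] dvd skew_mult \<alpha> (q - ?q) ?p"
        using const_dvd_skew_mult[OF q, of 1] by (simp add: hom const_poly_dvd_iff)
      moreover have "[:fps_X ^ Suc k:] dvd skew_mult \<alpha> q (p - ?p)"
        using const_dvd_skew_mult[OF _ p(2) dvd_power_image[OF X], of 1]
        by (simp add: const_poly_dvd_iff)
      ultimately have "[:fps_X ^ Suc k:] dvd z - skew_mult \<alpha> q p"
        using A(4)[of k] by (simp only: dvd_add dvd_diff)
      then show "fps_X ^ Suc k dvd coeff (z - skew_mult \<alpha> q p) i"
        unfolding const_poly_dvd_iff by blast
    qed
    then show "coeff (z - skew_mult \<alpha> q p) i = coeff 0 i" by simp
  qed
  ultimately show ?thesis by (intro exI[of _ q] exI[of _ p]) simp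
qed

section \<open>Reducibility and the factorization theorem\<close>

lemma (in ring_endomorphism) skew_mult_reducible:
  assumes "inj \<alpha>" "0 < degree p" "0 < degree q"
  shows "reducible (skew_poly_ring \<alpha>) (skew_mult \<alpha> q p)"
proof -
  have "p \<notin> Units (skew_poly_ring \<alpha>)" if "0 < degree p" for p
  proof
    assume "p \<in> Units (skew_poly_ring \<alpha>)"
    then obtain u where u: "skew_mult \<alpha> u p = 1" by (auto simp: Units_def skew_poly_ring_def)
    then have "u \<noteq> 0" "p \<noteq> 0"
      by (auto simp: skew_mult_zero_left skew_mult_zero_right)
    then show False using degree_skew_mult[OF \<open>inj \<alpha>\<close>, of u p] u that by simp
  qed
  then show ?thesis unfolding reducible_def using assms
    by (intro bexI[of _ q] bexI[of _ p]) (auto simp: skew_poly_ring_def)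
qed

theorem lemma6p8:
  fixes \<alpha> :: "'k::field fps \<Rightarrow> 'k fps"
    and f g :: "nat \<Rightarrow> 'k fps"
    and n m :: nat
    and z :: "'k fps poly"
  assumes "fps_algebra_automorphism \<alpha>"
    and "1 \<le> n" and "n < m"
    and "z = (\<Sum>i=0..n. monom (f i) i) + (\<Sum>i=n+1..m. monom (g i) i)"
    and "g m \<noteq> 0"
    and "is_unit (f n)"
    and "\<And>i. n + 1 \<le> i \<Longrightarrow> i \<le> m \<Longrightarrow> \<not> is_unit (g i)"
  shows "(\<exists>p. lead_coeff p = 1 \<and> degree p = n \<and>
            (\<exists>q. z = q \<otimes>\<^bsub>skew_poly_ring \<alpha>\<^esub> p))
         \<and> reducible (skew_poly_ring \<alpha>) z"
proof -
  have bij: "bij \<alpha>"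
    and hom: "\<alpha> 1 = 1" "\<And>a b. \<alpha> (a + b) = \<alpha> a + \<alpha> b" "\<And>a b. \<alpha> (a * b) = \<alpha> a * \<alpha> b"
    using assms(1) unfolding fps_algebra_automorphism_def by blast+
  interpret ring_endomorphism \<alpha> by standard (fact hom)+
  have coeff_z: "coeff z i = (if i \<le> n then f i else if i \<le> m then g i else 0)" for i
    unfolding assms(4) by (simp add: coeff_sum)
  have deg_z: "degree z = m"
  proof (rule antisym)
    show "degree z \<le> m" using \<open>n < m\<close> by (intro degree_le) (simp add: coeff_z)
    show "m \<le> degree z" using \<open>n < m\<close> \<open>g m \<noteq> 0\<close> by (intro le_degree) (simp add: coeff_z)
  qed
  have X: "fps_X dvd \<alpha> fps_X" by (rule fps_X_dvd_image) (fact bij hom)+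
  have "fps_X dvd coeff z i" if "n < i" for i
    using assms(7)[of i] that fps_X_power_dvd_iff[of 1 "g i"] by (auto simp: coeff_z)
  moreover have "is_unit (coeff z n)" using assms(6) by (simp add: coeff_z)
  ultimately obtain q p where qp: "degree p = n" "lead_coeff p = 1" "z = skew_mult \<alpha> q p"
    using skew_preparation[OF ring_endomorphism_axioms X, of z m n] deg_z \<open>n < m\<close>
    by auto
  have "0 < degree q"
    using degree_skew_mult_le[of q p] deg_z qp \<open>n < m\<close> by simp
  then have "reducible (skew_poly_ring \<alpha>) z"
    using skew_mult_reducible[OF bij_is_inj[OF bij], of p q] qp \<open>1 \<le> n\<close> by simp
  then show ?thesis using qp by (auto simp: skew_poly_ring_def)
qed

end
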